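(* Let $\lambda$ be a partition with $\ell(\lambda)$ nonzero parts. Then $$Q_\lambda=\begin{cases}-\displaystyle\sum_{r\geq1}(-1)^rq_rQ_{\lambda/(r)}&\text{if }\ell(\lambda)\text{ is odd},\\[2mm] \displaystyle\sum_{r\geq0}(-1)^rq_rQ_{\lambda/(r)}&\text{if }\ell(\lambda)\text{ is even}.\end{cases}$$
   Context: Let $x_1,x_2,\ldots$ be variables and define symmetric functions $q_n$ ($n\in\mathbb{Z}$) by $\prod_{i\ge1}\frac{1+zx_i}{1-zx_i}=\sum_{n\in\mathbb{Z}}q_nz^n$; so $q_0=1$ and $q_n=0$ for $n<0$. For $r,s\in\mathbb{Z}$ put $Q_{(r,s)}:=q_rq_s+2\sum_{i=1}^s(-1)^iq_{r+i}q_{s-i}$ (the sum is empty if $s<1$). A composition is a finite sequence of integers; a partition is a weakly decreasing composition with nonnegative parts. For a composition $\nu=(\nu_1,\ldots,\nu_N)$ let $M(\nu)$ be the $N\times N$ skew-symmetric matrix with $ij$-entry $Q_{(\nu_i,\nu_j)}$ if $i<j$, $0$ if $i=j$, and $-Q_{(\nu_j,\nu_i)}$ if $i>j$. For $\lambda\in\mathbb{Z}^n$ put $\lambda0:=(\lambda_1,\ldots,\lambda_n,0)$ and define $Q_\lambda:=\operatorname{Pf}M(\lambda)$ if $n$ is even and $Q_\lambda:=\operatorname{Pf}M(\lambda0)$ if $n$ is odd. Here $\operatorname{Pf}$ is the Pfaffian, normalized by $\operatorname{Pf}M=\sum_{j=2}^{2N}(-1)^jm_{1j}\operatorname{Pf}M_{1j}$,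 where $M_{1j}$ is $M$ with rows and columns $1,j$ deleted; the empty Pfaffian is $1$. For $\lambda\in\mathbb{Z}^n$, $\mu\in\mathbb{Z}^m$, let $N(\lambda,\mu)$ be the $n\times m$ matrix with $(i,j)$ entry $q_{\lambda_i-\mu_{m+1-j}}$, and $M(\lambda,\mu):=\begin{pmatrix}M(\lambda)&N(\lambda,\mu)\\-N(\lambda,\mu)^t&0\end{pmatrix}$. The skew function is $Q_{\lambda/\mu}:=\operatorname{Pf}M(\lambda,\mu)$ if $n+m$ is even and $\operatorname{Pf}M(\lambda0,\mu)$ if $n+m$ is odd. In $Q_{\lambda/(r)}$, $(r)$ is the one-part composition ($m=1$), also for $r=0$. *)

theory Defs
  imports
    "HOL-Library.Poly_Mapping"
    "HOL-Computational_Algebra.Formal_Power_Series"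
    "Jordan_Normal_Form.Determinant"
begin

text \<open>
  Formal power series with integer coefficients in infinitely many variables, the ring in which
  symmetric functions live. A monomial is its finitely supported exponent vector; the variable
  \<open>mvar i\<close> stands for \<open>x\<^sub>i\<^sub>+\<^sub>1\<close>.
\<close>

type_synonym monomial = "nat \<Rightarrow>\<^sub>0 nat"

typedef mps = "UNIV :: (monomial \<Rightarrow> int) set"
  morphisms mcoeff Abs_mps ..

lemma mcoeff_Abs [simp]: "mcoeff (Abs_mps f) = f"
  by (simp add: Abs_mps_inverse)

lemma mps_eqI: "(\<And>m. mcoeff f m = mcoeff g m) \<Longrightarrow> f = g"
  by (simp add: mcoeff_inject[symmetric] fun_eq_iff)

lemma finite_monomial_splits: "finite {(a, b). a + b = (m :: monomial)}"
proof -
  let ?K = "Poly_Mapping.keys m"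
  let ?B = "\<Union>i\<in>?K. {..Poly_Mapping.lookup m i}"
  let ?F = "{f. \<forall>i. (i \<in> ?K \<longrightarrow> f i \<in> ?B) \<and> (i \<notin> ?K \<longrightarrow> f i = (0::nat))}"
  have "finite ?F"
    by (rule finite_set_of_finite_funs) simp_all
  moreover have "Poly_Mapping.lookup a \<in> ?F" if "a + b = m" for a b
  proof -
    have le: "Poly_Mapping.lookup a i \<le> Poly_Mapping.lookup m i" for i
      unfolding that[symmetric] by (simp add: lookup_add)
    have "Poly_Mapping.lookup a i \<in> ?B" if "i \<in> ?K" for i
      using le that by blast
    moreover have "Poly_Mapping.lookup a i = 0" if "i \<notin> ?K" for i
      using le[of i] that by (simp add: in_keys_iff)
    ultimately show ?thesis
      by blast
  qed
  then have "Poly_Mapping.lookup ` {a. \<exists>b. a + b = m} \<subseteq> ?F"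
    by (intro image_subsetI) (elim CollectE exE)
  ultimately have "finite (Poly_Mapping.lookup ` {a. \<exists>b. a + b = m})"
    by (rule rev_finite_subset)
  moreover have "inj_on Poly_Mapping.lookup {a. \<exists>b. a + b = m}"
    by (meson inj_onI lookup_inject)
  ultimately have "finite {a. \<exists>b. a + b = m}"
    by (rule finite_imageD)
  then have "finite ((\<lambda>a. (a, m - a)) ` {a. \<exists>b. a + b = m})"
    by simp
  moreover have "{(a, b). a + b = m} \<subseteq> (\<lambda>a. (a, m - a)) ` {a. \<exists>b. a + b = m}"
    by (auto simp: image_iff)
  ultimately show ?thesis
    by (rule rev_finite_subset)
qed

instantiation mps :: comm_ring_1
begin

definition "0 = Abs_mps (\<lambda>_. 0)"
definition "1 = Abs_mps (\<lambda>m. if m = 0 then 1 else 0)"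
definition "f + g = Abs_mps (\<lambda>m. mcoeff f m + mcoeff g m)"
definition "f - g = Abs_mps (\<lambda>m. mcoeff f m - mcoeff g m)"
definition "- f = Abs_mps (\<lambda>m. - mcoeff f m)"
definition "f * g = Abs_mps (\<lambda>m. \<Sum>(a, b) | a + b = m. mcoeff f a * mcoeff g b)"

lemma mcoeff_simps [simp]:
  "mcoeff 0 m = 0"
  "mcoeff 1 m = (if m = 0 then 1 else 0)"
  "mcoeff (f + g) m = mcoeff f m + mcoeff g m"
  "mcoeff (f - g) m = mcoeff f m - mcoeff g m"
  "mcoeff (- f) m = - mcoeff f m"
  by (simp_all add: zero_mps_def one_mps_def plus_mps_def minus_mps_def uminus_mps_def)

lemma mcoeff_mult: "mcoeff (f * g) m = (\<Sum>(a, b) | a + b = m. mcoeff f a * mcoeff g b)"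
  by (simp add: times_mps_def)

instance
proof
  fix f g h :: mps
  show "f * g * h = f * (g * h)"
  proof (rule mps_eqI)
    fix m
    have "mcoeff (f * g * h) m =
        (\<Sum>p | fst p + snd p = m. \<Sum>r | fst r + snd r = fst p.
          mcoeff f (fst r) * mcoeff g (snd r) * mcoeff h (snd p))"
      by (simp add: mcoeff_mult case_prod_unfold sum_distrib_right)
    also have "\<dots> = (\<Sum>(p, r) \<in> (SIGMA p : {p. fst p + snd p = m}. {r. fst r + snd r = fst p}).
          mcoeff f (fst r) * mcoeff g (snd r) * mcoeff h (snd p))"
      using finite_monomial_splits
      by (subst sum.Sigma) (auto simp: case_prod_unfold)
    also have "\<dots> = (\<Sum>(p, r) \<in> (SIGMA p : {p. fst p + snd p = m}. {r. fst r + snd r = snd p}).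
          mcoeff f (fst p) * (mcoeff g (fst r) * mcoeff h (snd r)))"
      by (rule sum.reindex_bij_witness
          [where i = "\<lambda>(p, r). ((fst p + fst r, snd r), (fst p, fst r))"
             and j = "\<lambda>(p, r). ((fst r, snd r + snd p), (snd r, snd p))"])
         (auto simp: add.assoc mult.assoc)
    also have "\<dots> = (\<Sum>p | fst p + snd p = m. \<Sum>r | fst r + snd r = snd p.
          mcoeff f (fst p) * (mcoeff g (fst r) * mcoeff h (snd r)))"
      using finite_monomial_splits
      by (subst sum.Sigma) (auto simp: case_prod_unfold)
    also have "\<dots> = mcoeff (f * (g * h)) m"
      by (simp add: mcoeff_mult case_prod_unfold sum_distrib_left)
    finally show "mcoeff (f * g * h) m = mcoeff (f * (g * h)) m" .
  qed
  show "f * g = g * f"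
  proof (rule mps_eqI)
    fix m
    show "mcoeff (f * g) m = mcoeff (g * f) m"
      unfolding mcoeff_mult
      by (rule sum.reindex_bij_witness[where i = "\<lambda>(a, b). (b, a)" and j = "\<lambda>(a, b). (b, a)"])
         (auto simp: algebra_simps)
  qed
  show "1 * f = f"
  proof (rule mps_eqI)
    fix m
    have "mcoeff (1 * f) m = (\<Sum>(a, b) \<in> {(0, m)}. mcoeff 1 a * mcoeff f b)"
      unfolding mcoeff_mult
      by (rule sum.mono_neutral_right) (use finite_monomial_splits in \<open>auto split: if_splits\<close>)
    then show "mcoeff (1 * f) m = mcoeff f m"
      by simp
  qed
  show "(f + g) * h = f * h + g * h"
    by (rule mps_eqI) (simp add: mcoeff_mult case_prod_unfold algebra_simps sum.distrib)
  show "(0::mps) \<noteq> 1"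
    by (metis mcoeff_simps(1,2) zero_neq_one)
qed (auto intro!: mps_eqI simp: algebra_simps)

end

text \<open>The topology of coefficientwise convergence (each coefficient being eventually constant).\<close>

instantiation mps :: t2_space
begin

definition "open (U :: mps set) \<longleftrightarrow>
  (\<forall>f\<in>U. \<exists>S. finite S \<and> (\<forall>g. (\<forall>m\<in>S. mcoeff g m = mcoeff f m) \<longrightarrow> g \<in> U))"

instance
proof
  show "open (UNIV :: mps set)"
    by (auto simp: open_mps_def)
next
  fix U V :: "mps set"
  assume U: "open U" and V: "open V"
  show "open (U \<inter> V)"
    unfolding open_mps_def
  proof
    fix f assume "f \<in> U \<inter> V"
    then have f: "f \<in> U" "f \<in> V"
      by auto
    obtain S where "finite S" "\<forall>g. (\<forall>m\<in>S. mcoeff g m = mcoeff f m) \<longrightarrow> g \<in> U"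
      using bspec[OF U[unfolded open_mps_def] f(1)] by (elim exE conjE)
    moreover obtain T where "finite T" "\<forall>g. (\<forall>m\<in>T. mcoeff g m = mcoeff f m) \<longrightarrow> g \<in> V"
      using bspec[OF V[unfolded open_mps_def] f(2)] by (elim exE conjE)
    ultimately show "\<exists>S. finite S \<and> (\<forall>g. (\<forall>m\<in>S. mcoeff g m = mcoeff f m) \<longrightarrow> g \<in> U \<inter> V)"
      by (intro exI[of _ "S \<union> T"]) auto
  qed
next
  fix K :: "mps set set"
  assume "\<forall>U\<in>K. open U"
  then show "open (\<Union>K)"
    unfolding open_mps_def by (meson UnionE UnionI)
next
  fix f g :: mps
  assume "f \<noteq> g"
  then obtain m where m: "mcoeff f m \<noteq> mcoeff g m"
    using mps_eqI by blast
  have "open {h. mcoeff h m = c}" for c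
    unfolding open_mps_def by (auto intro!: exI[of _ "{m}"])
  with m show "\<exists>U V. open U \<and> open V \<and> f \<in> U \<and> g \<in> V \<and> U \<inter> V = {}"
    by (intro exI[of _ "{h. mcoeff h m = mcoeff f m}"] exI[of _ "{h. mcoeff h m = mcoeff g m}"]) auto
qed

end

lemma tendsto_mps_iff:
  "(f \<longlongrightarrow> l) F \<longleftrightarrow> (\<forall>m. \<forall>\<^sub>F n in F. mcoeff (f n) m = mcoeff l m)"
proof
  assume f: "(f \<longlongrightarrow> l) F"
  show "\<forall>m. \<forall>\<^sub>F n in F. mcoeff (f n) m = mcoeff l m"
  proof
    fix m
    have "open {h. mcoeff h m = mcoeff l m}"
      unfolding open_mps_def by (auto intro!: exI[of _ "{m}"])
    from topological_tendstoD[OF f this] show "\<forall>\<^sub>F n in F. mcoeff (f n) m = mcoeff l m"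
      by simp
  qed
next
  assume *: "\<forall>m. \<forall>\<^sub>F n in F. mcoeff (f n) m = mcoeff l m"
  show "(f \<longlongrightarrow> l) F"
  proof (rule topological_tendstoI)
    fix U :: "mps set" assume "open U" "l \<in> U"
    then obtain S where S: "finite S" "\<And>g. (\<forall>m\<in>S. mcoeff g m = mcoeff l m) \<Longrightarrow> g \<in> U"
      unfolding open_mps_def by blast
    have "\<forall>\<^sub>F n in F. \<forall>m\<in>S. mcoeff (f n) m = mcoeff l m"
      using S(1) * by (simp add: eventually_ball_finite)
    then show "\<forall>\<^sub>F n in F. f n \<in> U"
      by (rule eventually_mono) (use S(2) in blast)
  qed
qed

definition mvar :: "nat \<Rightarrow> mps" where
  "mvar i = Abs_mps (\<lambda>m. if m = Poly_Mapping.single i 1 then 1 else 0)"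

lemma mcoeff_mvar: "mcoeff (mvar i) m = (if m = Poly_Mapping.single i 1 then 1 else 0)"
  by (simp add: mvar_def)

lemma mcoeff_mvar_power: "mcoeff (mvar i ^ k) m = (if m = Poly_Mapping.single i k then 1 else 0)"
proof (induction k arbitrary: m)
  case 0
  then show ?case by simp
next
  case (Suc k)
  let ?p = "(Poly_Mapping.single i 1, Poly_Mapping.single i k) :: monomial \<times> monomial"
  have "mcoeff (mvar i ^ Suc k) m = (\<Sum>p \<in> {(a, b). a + b = m}. if p = ?p then 1 else 0)"
    unfolding power_Suc mcoeff_mult
    by (rule sum.cong[OF refl]) (auto simp: mcoeff_mvar Suc.IH split: if_splits)
  also have "\<dots> = (if ?p \<in> {(a, b). a + b = m} then 1 else 0)"
    by (rule sum.delta[OF finite_monomial_splits])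
  finally show ?case
    by (simp add: single_add[symmetric] eq_commute)
qed

text \<open>The factor \<open>(1 + z x\<^sub>i) / (1 - z x\<^sub>i)\<close>, a power series in \<open>z = fps_X\<close>. The class-based
  inverse of \<^typ>\<open>'a fps\<close> needs an inverse operation on the coefficient ring, hence
  \<^term>\<open>fps_right_inverse\<close>, whose second argument is the inverse of the constant term.\<close>

definition q_factor :: "nat \<Rightarrow> mps fps" where
  "q_factor i = (1 + fps_X * fps_const (mvar i)) *
     fps_right_inverse (1 - fps_X * fps_const (mvar i)) 1"

lemma q_factor_eq:
  "(1 - fps_X * fps_const (mvar i)) * q_factor i = 1 + fps_X * fps_const (mvar i)"
proof -
  have "(1 - fps_X * fps_const (mvar i)) * fps_right_inverse (1 - fps_X * fps_const (mvar i)) 1 = 1"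
    by (rule fps_right_inverse) simp
  then show ?thesis
    unfolding q_factor_def by (simp add: mult.left_commute[of "1 - fps_X * fps_const (mvar i)"])
qed

text \<open>The infinite product over \<open>i\<close> is the coefficientwise limit of its partial products.\<close>

definition q :: "int \<Rightarrow> mps" where
  "q n = (if n < 0 then 0 else lim (\<lambda>N. fps_nth (\<Prod>i<N. q_factor i) (nat n)))"

lemma q_factor_nth: "fps_nth (q_factor i) n = (if n = 0 then 1 else 2 * mvar i ^ n)"
proof -
  let ?x = "mvar i" and ?G = "Abs_fps (\<lambda>n. if n = 0 then 1 else 2 * mvar i ^ n)"
  let ?D = "1 - fps_X * fps_const ?x" and ?R = "fps_right_inverse (1 - fps_X * fps_const (mvar i)) 1"
  have R: "?D * ?R = 1"
    by (rule fps_right_inverse) simp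
  have "?D * ?G = 1 + fps_X * fps_const ?x"
  proof (rule fps_ext)
    fix n
    show "fps_nth (?D * ?G) n = fps_nth (1 + fps_X * fps_const ?x) n"
      by (cases n; cases "n - 1") (simp_all add: left_diff_distrib mult.assoc)
  qed
  then have "?D * q_factor i = ?D * ?G"
    by (simp add: q_factor_eq)
  then have "?R * (?D * q_factor i) = ?R * (?D * ?G)"
    by (rule arg_cong)
  then have "(?D * ?R) * q_factor i = (?D * ?R) * ?G"
    by (simp only: mult.assoc mult.left_commute[of ?D ?R])
  then have "q_factor i = ?G"
    unfolding R by (simp only: mult_1_left)
  then show ?thesis
    by simp
qed

lemma q_tendsto:
  assumes "0 \<le> n"
  shows "(\<lambda>N. fps_nth (\<Prod>i<N. q_factor i) (nat n)) \<longlonglongrightarrow> q n"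
proof -
  define P where "P = (\<lambda>N k. fps_nth (\<Prod>i<N. q_factor i) k)"
  have step: "mcoeff (P (Suc N) k) m = mcoeff (P N k) m"
    if N: "Poly_Mapping.lookup m N = 0" for N k m
  proof -
    have z: "mcoeff (P N j * (2 * mvar N ^ l)) m = 0" if "l \<noteq> 0" for j l
    proof -
      have "mcoeff (P N j * mvar N ^ l) m = 0"
        unfolding mcoeff_mult mcoeff_mvar_power
      proof (rule sum.neutral, clarify)
        fix a b assume ab: "m = a + b"
        have "b \<noteq> Poly_Mapping.single N l"
          using N that unfolding ab by (auto simp: lookup_add)
        then show "mcoeff (P N j) a * (if b = Poly_Mapping.single N l then 1 else 0) = 0"
          by simp
      qed
      moreover have "P N j * (2 * mvar N ^ l) = P N j * mvar N ^ l + P N j * mvar N ^ l"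
        by (simp only: mult_2 distrib_left)
      ultimately show ?thesis
        by (simp only: mcoeff_simps add_0)
    qed
    have "P (Suc N) k = (\<Sum>j=0..k. P N j * (if k - j = 0 then 1 else 2 * mvar N ^ (k - j)))"
      unfolding P_def by (simp add: fps_mult_nth q_factor_nth)
    also have "\<dots> = (\<Sum>j=0..<k. P N j * (2 * mvar N ^ (k - j))) + P N k"
      by (simp add: atLeast0AtMost atLeast0LessThan lessThan_Suc_atMost[symmetric])
    finally have e: "P (Suc N) k = (\<Sum>j=0..<k. P N j * (2 * mvar N ^ (k - j))) + P N k" .
    have s: "mcoeff (sum f A) m = (\<Sum>j\<in>A. mcoeff (f j) m)" for f :: "nat \<Rightarrow> mps" and A
      by (induction A rule: infinite_finite_induct) auto
    show ?thesis
      unfolding e by (simp add: s z)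
  qed
  define b where "b m = Suc (Max (insert 0 (Poly_Mapping.keys m)))" for m :: monomial
  have b: "Poly_Mapping.lookup m N = 0" if "b m \<le> N" for m N
  proof (rule ccontr)
    assume "Poly_Mapping.lookup m N \<noteq> 0"
    then have "N \<le> Max (insert 0 (Poly_Mapping.keys m))"
      by (intro Max_ge) (auto simp: in_keys_iff)
    then show False
      using that by (simp add: b_def)
  qed
  have const: "mcoeff (P N k) m = mcoeff (P (b m) k) m" if "b m \<le> N" for N k m
    using that by (induction N rule: dec_induct) (simp_all add: step b)
  have "(\<lambda>N. P N (nat n)) \<longlonglongrightarrow> Abs_mps (\<lambda>m. mcoeff (P (b m) (nat n)) m)"
    unfolding tendsto_mps_iff eventually_sequentially mcoeff_Abs
    by (intro allI exI impI) (rule const)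
  then have "(\<lambda>N. P N (nat n)) \<longlonglongrightarrow> lim (\<lambda>N. P N (nat n))"
    by (simp add: limI)
  then show ?thesis
    using assms by (simp add: q_def P_def)
qed

definition Q2 :: "int \<Rightarrow> int \<Rightarrow> mps" where
  "Q2 r s = q r * q s + 2 * (\<Sum>i = 1..s. (-1) ^ nat i * q (r + i) * q (s - i))"

text \<open>
  Expansion of the Pfaffian along the first row. Matrix indices start at 0, so that the sign
  \<open>(-1)\<^sup>j\<close> of the one-based expansion becomes \<open>(-1)\<^sup>j\<^sup>+\<^sup>1\<close>.
\<close>

function pfaffian :: "'a :: comm_ring_1 mat \<Rightarrow> 'a" where
  "pfaffian M = (if dim_row M = 0 then 1
     else \<Sum>j = 1..<dim_row M.
       (-1) ^ (j + 1) * M $$ (0, j) * pfaffian (mat_delete (mat_delete M j j) 0 0))"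
  by auto
termination
  by (relation "measure dim_row") auto

declare pfaffian.simps [simp del]

definition M_mat :: "int list \<Rightarrow> mps mat" where
  "M_mat \<nu> = mat (length \<nu>) (length \<nu>) (\<lambda>(i, j).
     if i < j then Q2 (\<nu> ! i) (\<nu> ! j)
     else if i = j then 0
     else - Q2 (\<nu> ! j) (\<nu> ! i))"

definition Q :: "int list \<Rightarrow> mps" where
  "Q \<nu> = pfaffian (M_mat (if even (length \<nu>) then \<nu> else \<nu> @ [0]))"

text \<open>The columns of \<open>N(\<nu>, \<mu>)\<close> run through \<open>\<mu>\<close> backwards.\<close>

definition N_mat :: "int list \<Rightarrow> int list \<Rightarrow> mps mat" where
  "N_mat \<nu> \<mu> = mat (length \<nu>) (length \<mu>) (\<lambda>(i, j). q (\<nu> ! i - \<mu> ! (length \<mu> - 1 - j)))"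

definition M_skew_mat :: "int list \<Rightarrow> int list \<Rightarrow> mps mat" where
  "M_skew_mat \<nu> \<mu> = four_block_mat (M_mat \<nu>) (N_mat \<nu> \<mu>)
     (- transpose_mat (N_mat \<nu> \<mu>)) (0\<^sub>m (length \<mu>) (length \<mu>))"

definition Q_skew :: "int list \<Rightarrow> int list \<Rightarrow> mps" where
  "Q_skew \<nu> \<mu> =
     pfaffian (M_skew_mat (if even (length \<nu> + length \<mu>) then \<nu> else \<nu> @ [0]) \<mu>)"

text \<open>Trailing zeros are allowed, so that the length may exceed \<open>num_parts\<close>.\<close>

definition is_partition :: "int list \<Rightarrow> bool" where
  "is_partition \<nu> \<longleftrightarrow> sorted_wrt (\<ge>) \<nu> \<and> (\<forall>p\<in>set \<nu>. 0 \<le> p)"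

definition num_parts :: "int list \<Rightarrow> nat" where
  "num_parts \<nu> = length (filter (\<lambda>p. p \<noteq> 0) \<nu>)"

end

theory Submission
  imports Defs
begin

text \<open>
  Expanding the Pfaffian of \<open>M(\<lambda>,(r))\<close> along its last column reduces the sum over \<open>r\<close> to the
  convolutions \<open>\<Sum>\<^sub>r (-1)\<^sup>r q\<^sub>r q\<^sub>k\<^sub>-\<^sub>r\<close>, which vanish for \<open>k > 0\<close> because the generating
  function \<open>q(z)\<close> satisfies \<open>q(z) q(-z) = 1\<close>. Only the zero parts contribute, with alternating
  signs, so the sum over all \<open>r \<ge> 0\<close> depends on the parity of their number; when it vanishes, the
  terms with \<open>r \<ge> 1\<close> add up to minus the term \<open>r = 0\<close>, which is \<open>Q\<^sub>\<lambda>\<close>. Trailing zeros are harmless since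
  appending two zeros to a composition does not change the Pfaffian.
\<close>

section \<open>The relation \<open>q(z) q(-z) = 1\<close>\<close>

text \<open>This is \<open>f(-z)\<close>, given coefficientwise.\<close>

definition fps_alternate :: "'a :: comm_ring_1 fps \<Rightarrow> 'a fps" where
  "fps_alternate f = Abs_fps (\<lambda>n. (-1) ^ n * fps_nth f n)"

lemma fps_alternate_nth [simp]: "fps_nth (fps_alternate f) n = (-1) ^ n * fps_nth f n"
  by (simp add: fps_alternate_def)

lemma fps_alternate_1 [simp]: "fps_alternate 1 = 1"
  by (rule fps_ext) simp

lemma fps_alternate_mult: "fps_alternate (f * g) = fps_alternate f * fps_alternate g"
proof (rule fps_ext)
  fix n
  have "(-1 :: 'a) ^ n = (-1) ^ i * (-1) ^ (n - i)" if "i \<le> n" for i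
    using that by (simp add: power_add[symmetric])
  then show "fps_nth (fps_alternate (f * g)) n = fps_nth (fps_alternate f * fps_alternate g) n"
    by (simp add: fps_mult_nth sum_distrib_left mult_ac)
qed

text \<open>Replacing \<open>z\<close> by \<open>-z\<close> exchanges numerator and denominator of
  \<open>(1 + zx)/(1 - zx)\<close>. The inverse \<open>?R\<close> is handled through
  \<open>?D * ?R = 1\<close> and the image of this equation under the ring homomorphism
  \<open>fps_alternate\<close>.\<close>

lemma q_factor_alternate: "q_factor i * fps_alternate (q_factor i) = 1"
proof -
  let ?D = "1 - fps_X * fps_const (mvar i)"
  let ?R = "fps_right_inverse ?D 1"
  have DR: "?D * ?R = 1"
    by (rule fps_right_inverse) simp
  have D: "fps_alternate ?D = 1 + fps_X * fps_const (mvar i)"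
    "fps_alternate (1 + fps_X * fps_const (mvar i)) = ?D"
    by (rule fps_ext, simp add: fps_X_def)+
  have DR': "fps_alternate ?D * fps_alternate ?R = 1"
    using arg_cong[OF DR, of fps_alternate] by (simp only: fps_alternate_mult fps_alternate_1)
  have "q_factor i * fps_alternate (q_factor i) =
      (fps_alternate ?D * ?R) * (?D * fps_alternate ?R)"
    by (simp only: q_factor_def fps_alternate_mult D)
  also have "\<dots> = (?D * ?R) * (fps_alternate ?D * fps_alternate ?R)"
    by (simp only: mult_ac)
  finally show ?thesis
    by (simp only: DR DR' mult_1_left)
qed

lemma q_prod_alternate:
  "(\<Prod>i<N. q_factor i) * fps_alternate (\<Prod>i<N. q_factor i) = 1"
proof (induction N)
  case (Suc N)
  have "(\<Prod>i<Suc N. q_factor i) * fps_alternate (\<Prod>i<Suc N. q_factor i) =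
      ((\<Prod>i<N. q_factor i) * fps_alternate (\<Prod>i<N. q_factor i)) *
      (q_factor N * fps_alternate (q_factor N))"
    by (simp only: prod.lessThan_Suc fps_alternate_mult mult_ac)
  then show ?case
    by (simp only: Suc.IH q_factor_alternate mult_1_left)
qed simp

section \<open>Passage to the infinite product\<close>

lemma tendsto_mps_add:
  fixes f g :: "'a \<Rightarrow> mps"
  assumes "(f \<longlongrightarrow> a) F" "(g \<longlongrightarrow> b) F"
  shows "((\<lambda>x. f x + g x) \<longlongrightarrow> a + b) F"
  unfolding tendsto_mps_iff
proof
  fix m
  show "\<forall>\<^sub>F n in F. mcoeff (f n + g n) m = mcoeff (a + b) m"
    using assms[unfolded tendsto_mps_iff, rule_format, of m]
    by eventually_elim simp
qed

text \<open>A coefficient of a product involves only finitely many coefficients of the factors, and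
  these are eventually constant simultaneously.\<close>

lemma tendsto_mps_mult:
  fixes f g :: "'a \<Rightarrow> mps"
  assumes "(f \<longlongrightarrow> a) F" "(g \<longlongrightarrow> b) F"
  shows "((\<lambda>x. f x * g x) \<longlongrightarrow> a * b) F"
  unfolding tendsto_mps_iff
proof
  fix m :: monomial
  let ?S = "{(u, v). u + v = m}"
  have "\<forall>\<^sub>F n in F. \<forall>(u, v)\<in>?S. mcoeff (f n) u = mcoeff a u \<and> mcoeff (g n) v = mcoeff b v"
    using assms
    by (intro eventually_ball_finite finite_monomial_splits)
       (auto simp: tendsto_mps_iff intro: eventually_conj)
  then show "\<forall>\<^sub>F n in F. mcoeff (f n * g n) m = mcoeff (a * b) m"
    by eventually_elim (auto simp: mcoeff_mult intro!: sum.cong)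
qed

lemma tendsto_mps_sum:
  fixes f :: "'a \<Rightarrow> 'b \<Rightarrow> mps"
  assumes "\<And>i. i \<in> I \<Longrightarrow> ((\<lambda>x. f i x) \<longlongrightarrow> a i) F"
  shows "((\<lambda>x. \<Sum>i\<in>I. f i x) \<longlongrightarrow> (\<Sum>i\<in>I. a i)) F"
  using assms by (induction I rule: infinite_finite_induct) (auto intro: tendsto_mps_add)

lemma q_neg [simp]: "n < 0 \<Longrightarrow> q n = 0"
  by (simp add: q_def)

text \<open>This compares coefficients of \<open>z^k\<close> in \<open>q(-z) q(z) = 1\<close>. The
  identity holds for every partial product, and the finite sum passes to the limit, which is
  unique.\<close>

lemma q_convolution:
  "(\<Sum>r\<le>k. (-1) ^ r * q (int r) * q (int k - int r)) = (if k = 0 then 1 else 0)"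
proof -
  let ?P = "\<lambda>N. \<Prod>i<N. q_factor i"
  have lim: "(\<lambda>N. fps_nth (?P N) n) \<longlonglongrightarrow> q (int n)" for n
    using q_tendsto[of "int n"] by simp
  have "(\<lambda>N. \<Sum>r\<le>k. (-1) ^ r * fps_nth (?P N) r * fps_nth (?P N) (k - r))
      \<longlonglongrightarrow> (\<Sum>r\<le>k. (-1) ^ r * q (int r) * q (int (k - r)))"
    by (intro tendsto_mps_sum tendsto_mps_mult tendsto_const lim)
  moreover have "(\<Sum>r\<le>k. (-1) ^ r * fps_nth (?P N) r * fps_nth (?P N) (k - r)) =
      (if k = 0 then 1 else 0)" for N
  proof -
    have "fps_nth (fps_alternate (?P N) * ?P N) k = (if k = 0 then 1 else 0)"
      by (subst mult.commute) (simp add: q_prod_alternate)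
    then show ?thesis
      by (simp add: fps_mult_nth atLeast0AtMost)
  qed
  ultimately have "(\<lambda>N :: nat. if k = 0 then 1 else 0)
      \<longlonglongrightarrow> (\<Sum>r\<le>k. (-1) ^ r * q (int r) * q (int (k - r)))"
    by simp
  then have "(\<Sum>r\<le>k. (-1) ^ r * q (int r) * q (int (k - r))) = (if k = 0 then 1 else 0)"
    by (rule LIMSEQ_unique) (rule tendsto_const)
  then show ?thesis
    by simp
qed

lemma q_0 [simp]: "q 0 = 1"
proof -
  have "fps_nth (\<Prod>i<N. q_factor i) 0 = 1" for N
    by (induction N) (simp_all add: q_factor_nth)
  then have "(\<lambda>N :: nat. 1) \<longlonglongrightarrow> q 0"
    using q_tendsto[of 0] by simp
  then show ?thesis
    by (rule LIMSEQ_unique) (rule tendsto_const)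
qed

text \<open>Terms with \<open>r > a\<close> vanish because \<open>q\<close> is zero at negative
  indices, so a single cutoff \<open>R\<close> can serve all parts of a partition at once.\<close>

lemma q_convolution_upto:
  assumes "0 \<le> a" "a < int R"
  shows "(\<Sum>r<R. (-1) ^ r * q (int r) * q (a - int r)) = (if a = 0 then 1 else 0)"
proof -
  have "(\<Sum>r<R. (-1) ^ r * q (int r) * q (a - int r)) =
      (\<Sum>r\<le>nat a. (-1) ^ r * q (int r) * q (a - int r))"
  proof (intro sum.mono_neutral_right ballI)
    show "{..nat a} \<subseteq> {..<R}"
      using assms by auto
    show "(-1) ^ r * q (int r) * q (a - int r) = 0" if "r \<in> {..<R} - {..nat a}" for r
    proof -
      have "a - int r < 0"
        using that assms by auto
      then show ?thesis
        by simp
    qed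
  qed simp
  then show ?thesis
    using q_convolution[of "nat a"] assms by simp
qed

lemma Q2_0_right [simp]: "Q2 r 0 = q r"
  by (simp add: Q2_def)

section \<open>Pfaffians indexed by lists\<close>

definition del_nth :: "nat \<Rightarrow> 'a list \<Rightarrow> 'a list" where
  "del_nth i xs = take i xs @ drop (Suc i) xs"

lemma length_del_nth [simp]: "i < length xs \<Longrightarrow> length (del_nth i xs) = length xs - 1"
  by (simp add: del_nth_def)

lemma nth_del_nth:
  "i < length xs \<Longrightarrow> k < length xs - 1 \<Longrightarrow> del_nth i xs ! k = xs ! (if k < i then k else Suc k)"
  by (auto simp: del_nth_def nth_append min_def)

lemma del_nth_Cons_0 [simp]: "del_nth 0 (x # xs) = xs"
  and del_nth_Cons_Suc [simp]: "del_nth (Suc i) (x # xs) = x # del_nth i xs"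
  by (simp_all add: del_nth_def)

lemma del_nth_append:
  "del_nth i (xs @ ys) = (if i < length xs then del_nth i xs @ ys else xs @ del_nth (i - length xs) ys)"
  by (auto simp: del_nth_def Suc_diff_le)

lemma del_nth_map: "del_nth i (map h xs) = map h (del_nth i xs)"
  by (simp add: del_nth_def take_map drop_map)

lemma del_nth_replicate: "i < n \<Longrightarrow> del_nth i (replicate n x) = replicate (n - 1) x"
  by (simp add: del_nth_def min_def replicate_add[symmetric])

text \<open>Deleting position \<open>j\<close> and then position \<open>i\<close> of the remainder is the same as deleting the two
  positions in the opposite order; the following involution translates the indices.\<close>

definition swap_del :: "nat \<times> nat \<Rightarrow> nat \<times> nat" where
  "swap_del = (\<lambda>(j, i). if i < j then (i, j - 1) else (Suc i, j))"

lemma del_nth_del_nth: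
  assumes "j < length xs" "i < length xs - 1" "swap_del (j, i) = (j', i')"
  shows "del_nth i (del_nth j xs) = del_nth i' (del_nth j' xs)"
  using assms
  by (intro nth_equalityI) (auto simp: nth_del_nth swap_del_def split: if_splits)

text \<open>The Pfaffian of the skew-symmetric matrix with entries
  \<open>f (xs ! i) (xs ! j)\<close> above the diagonal. Labelling rows by list entries turns minors
  into deletions from the list. Position \<open>j\<close> of the tail is column \<open>j + 2\<close>
  in one-based counting, hence the sign \<open>(-1) ^ j\<close>.\<close>

function pf :: "('a \<Rightarrow> 'a \<Rightarrow> 'b :: comm_ring_1) \<Rightarrow> 'a list \<Rightarrow> 'b" where
  "pf f [] = 1"
| "pf f (x # xs) = (\<Sum>j<length xs. (-1) ^ j * f x (xs ! j) * pf f (del_nth j xs))"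
  by pat_completeness auto
termination
  by (relation "measure (length \<circ> snd)") auto

lemma pfaffian_eq_pf:
  assumes "M \<in> carrier_mat (length xs) (length xs)"
    and "\<And>i j. i < j \<Longrightarrow> j < length xs \<Longrightarrow> M $$ (i, j) = f (xs ! i) (xs ! j)"
  shows "pfaffian M = pf f xs"
  using assms
proof (induction "length xs" arbitrary: M xs rule: less_induct)
  case less
  show ?case
  proof (cases xs)
    case Nil
    then show ?thesis
      using less.prems by (simp add: pfaffian.simps)
  next
    case (Cons x ys)
    have dims: "dim_row M = Suc (length ys)" "dim_col M = Suc (length ys)"
      using less.prems(1) Cons by auto
    have minor: "pfaffian (mat_delete (mat_delete M (Suc j) (Suc j)) 0 0) = pf f (del_nth j ys)"
      if j: "j < length ys" for j
    proof (rule less.hyps)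
      show "length (del_nth j ys) < length xs"
        using j Cons by simp
      show "mat_delete (mat_delete M (Suc j) (Suc j)) 0 0
          \<in> carrier_mat (length (del_nth j ys)) (length (del_nth j ys))"
        by (rule carrier_matI) (simp_all only: mat_delete_dim dims length_del_nth[OF j] diff_Suc_1)
    next
      fix i k assume ik: "i < k" "k < length (del_nth j ys)"
      \<comment> \<open>Row \<open>i\<close> of the minor is traced back to \<open>M\<close>: one
        shift for the deleted row 0, a second one from the deleted row \<open>Suc j\<close>
        on.\<close>
      define i' where "i' = (if i < j then Suc i else Suc (Suc i))"
      define k' where "k' = (if k < j then Suc k else Suc (Suc k))"
      have "mat_delete (mat_delete M (Suc j) (Suc j)) 0 0 $$ (i, k) = M $$ (i', k')"
        using j ik by (simp add: mat_delete_def dims i'_def k'_def)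
      also have "\<dots> = f (xs ! i') (xs ! k')"
        using j ik by (intro less.prems(2)) (auto simp: i'_def k'_def Cons)
      also have "\<dots> = f (del_nth j ys ! i) (del_nth j ys ! k)"
        using j ik by (auto simp: i'_def k'_def Cons nth_del_nth)
      finally show "mat_delete (mat_delete M (Suc j) (Suc j)) 0 0 $$ (i, k) =
          f (del_nth j ys ! i) (del_nth j ys ! k)" .
    qed
    have "pfaffian M = (\<Sum>j<length ys. (-1) ^ (Suc j + 1) * M $$ (0, Suc j) *
        pfaffian (mat_delete (mat_delete M (Suc j) (Suc j)) 0 0))"
      by (subst pfaffian.simps)
         (simp add: dims sum.atLeast_Suc_lessThan_Suc_shift atLeast0LessThan del: sum.op_ivl_Suc)
    also have "\<dots> = pf f xs"
      using less.prems(2)[of 0] by (simp add: Cons minor)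
    finally show ?thesis .
  qed
qed

lemma pf_map: "pf f (map h xs) = pf (\<lambda>x y. f (h x) (h y)) xs"
  by (induction "length xs" arbitrary: xs rule: less_induct) (case_tac xs; simp add: del_nth_map)

text \<open>Expand along the first row, expand each minor along its last column by induction, and
  exchange the two sums: the inner sums then reassemble into first-row expansions.\<close>

lemma pf_last_column:
  assumes "odd (length xs)"
  shows "pf f (xs @ [y]) = (\<Sum>i<length xs. (-1) ^ i * f (xs ! i) y * pf f (del_nth i xs))"
  using assms
proof (induction "length xs" arbitrary: xs rule: less_induct)
  case less
  then obtain x ys where xs: "xs = x # ys"
    by (cases xs) auto
  let ?m = "length ys"
  let ?S = "{..<?m} \<times> {..<?m - 1}"
  have even: "even ?m"
    using less.prems xs by simp
  \<comment> \<open>The pairing of \<open>x\<close> with \<open>y\<close> is split off; its sign is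
    \<open>+1\<close> since \<open>?m\<close> is even, and it becomes the term \<open>i = 0\<close>
    of the claim.\<close>
  have "pf f (xs @ [y]) =
      (\<Sum>j<?m. (-1) ^ j * f x (ys ! j) * pf f (del_nth j ys @ [y])) + f x y * pf f ys"
    using even by (simp add: xs nth_append del_nth_append)
  also have "(\<Sum>j<?m. (-1) ^ j * f x (ys ! j) * pf f (del_nth j ys @ [y])) =
      (\<Sum>j<?m. \<Sum>i<?m - 1. (-1) ^ j * f x (ys ! j) *
        ((-1) ^ i * f (del_nth j ys ! i) y * pf f (del_nth i (del_nth j ys))))"
  proof (intro sum.cong refl)
    fix j assume "j \<in> {..<?m}"
    then show "(-1) ^ j * f x (ys ! j) * pf f (del_nth j ys @ [y]) =
      (\<Sum>i<?m - 1. (-1) ^ j * f x (ys ! j) *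
        ((-1) ^ i * f (del_nth j ys ! i) y * pf f (del_nth i (del_nth j ys))))"
      using even by (subst less.hyps) (auto simp: xs sum_distrib_left)
  qed
  also have "\<dots> = (\<Sum>(j, i)\<in>?S. (-1) ^ j * f x (ys ! j) *
        ((-1) ^ i * f (del_nth j ys ! i) y * pf f (del_nth i (del_nth j ys))))"
    by (rule sum.cartesian_product)
  \<comment> \<open>The roles change: \<open>j\<close> now marks the entry paired with
    \<open>y\<close>, and \<open>i\<close> the one paired with \<open>x\<close>.\<close>
  also have "\<dots> = (\<Sum>(j, i)\<in>?S. (-1) ^ Suc j * f (ys ! j) y *
        ((-1) ^ i * f x (del_nth j ys ! i) * pf f (del_nth i (del_nth j ys))))"
  proof (rule sum.reindex_bij_witness[where i = swap_del and j = swap_del])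
    fix p assume p: "p \<in> ?S"
    have "swap_del (swap_del p) = p \<and> swap_del p \<in> ?S"
      using p by (auto simp: swap_del_def split: if_splits)
    then show "swap_del (swap_del p) = p" "swap_del p \<in> ?S"
      "swap_del (swap_del p) = p" "swap_del p \<in> ?S"
      by simp_all
    obtain j i where ji: "p = (j, i)" "j < ?m" "i < ?m - 1"
      using p by auto
    obtain j' i' where s: "swap_del (j, i) = (j', i')"
      by fastforce
    \<comment> \<open>\<open>swap_del\<close> changes the parity of \<open>j + i\<close>, which the
      extra sign in \<open>Suc j'\<close> compensates.\<close>
    have sign: "(-1 :: 'b) ^ Suc j' * (-1) ^ i' = (-1) ^ j * (-1) ^ i"
      using s by (cases j) (auto simp: swap_del_def split: if_splits)
    have "del_nth j ys ! i = ys ! j'" "del_nth j' ys ! i' = ys ! j"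
      using ji s by (auto simp: swap_del_def nth_del_nth split: if_splits)
    then have "(-1) ^ Suc j' * f (ys ! j') y *
        ((-1) ^ i' * f x (del_nth j' ys ! i') * pf f (del_nth i' (del_nth j' ys))) =
        ((-1) ^ Suc j' * (-1) ^ i') * (f (del_nth j ys ! i) y * f x (ys ! j)) *
          pf f (del_nth i (del_nth j ys))"
      using del_nth_del_nth[OF ji(2,3) s] by (simp only: mult_ac)
    also have "\<dots> = (-1) ^ j * f x (ys ! j) *
        ((-1) ^ i * f (del_nth j ys ! i) y * pf f (del_nth i (del_nth j ys)))"
      unfolding sign by (simp only: mult_ac)
    finally show "(case swap_del p of (j, i) \<Rightarrow> (-1) ^ Suc j * f (ys ! j) y *
        ((-1) ^ i * f x (del_nth j ys ! i) * pf f (del_nth i (del_nth j ys)))) =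
      (case p of (j, i) \<Rightarrow> (-1) ^ j * f x (ys ! j) *
        ((-1) ^ i * f (del_nth j ys ! i) y * pf f (del_nth i (del_nth j ys))))"
      by (simp add: ji(1) s)
  qed
  also have "\<dots> = (\<Sum>j<?m. \<Sum>i<?m - 1. (-1) ^ Suc j * f (ys ! j) y *
        ((-1) ^ i * f x (del_nth j ys ! i) * pf f (del_nth i (del_nth j ys))))"
    by (rule sum.cartesian_product[symmetric])
  also have "\<dots> = (\<Sum>j<?m. (-1) ^ Suc j * f (ys ! j) y * pf f (x # del_nth j ys))"
    by (simp add: sum_distrib_left)
  finally show ?case
    by (simp add: xs sum.lessThan_Suc_shift del: pf.simps power_Suc sum.lessThan_Suc)
qed

section \<open>Schur Q-functions\<close>

lemma pfaffian_M_mat: "pfaffian (M_mat xs) = pf Q2 xs"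
  by (rule pfaffian_eq_pf) (auto simp: M_mat_def)

text \<open>Expansion along the column contributed by \<open>[r]\<close>; the minors no longer
  depend on \<open>r\<close>.\<close>

lemma pfaffian_M_skew_mat:
  assumes "odd (length xs)"
  shows "pfaffian (M_skew_mat xs [r]) =
    (\<Sum>i<length xs. (-1) ^ i * q (xs ! i - r) * pf Q2 (del_nth i xs))"
proof -
  \<comment> \<open>\<open>None\<close> labels the additional row and column, keeping it distinct
    from any part equal to \<open>r\<close>.\<close>
  define g where "g = (\<lambda>a b. case (a, b) of (Some x, Some y) \<Rightarrow> Q2 x y
    | (Some x, None) \<Rightarrow> q (x - r) | _ \<Rightarrow> 0)"
  have "pfaffian (M_skew_mat xs [r]) = pf g (map Some xs @ [None])"
    by (rule pfaffian_eq_pf)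
       (auto simp: M_skew_mat_def M_mat_def N_mat_def g_def nth_append less_Suc_eq)
  also have "\<dots> = (\<Sum>i<length xs. (-1) ^ i * q (xs ! i - r) * pf Q2 (del_nth i xs))"
    using assms by (subst pf_last_column) (auto simp: del_nth_map pf_map g_def)
  finally show ?thesis .
qed

text \<open>In the first-row expansion the pairings with the two zeros leave the same list and have
  opposite signs, so they cancel; the other minors are covered by induction.\<close>

lemma pf_Q2_append_0_0: "pf Q2 (xs @ [0, 0]) = pf Q2 xs"
proof (induction "length xs" arbitrary: xs rule: less_induct)
  case less
  show ?case
  proof (cases xs)
    case Nil
    then show ?thesis
      by simp
  next
    case (Cons x ys)
    let ?m = "length ys"
    have "pf Q2 (xs @ [0, 0]) =
        (\<Sum>j<?m. (-1) ^ j * Q2 x (ys ! j) * pf Q2 (del_nth j ys @ [0, 0])) +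
        (-1) ^ ?m * q x * pf Q2 (ys @ [0]) + (-1) ^ Suc ?m * q x * pf Q2 (ys @ [0])"
      by (simp add: Cons nth_append del_nth_append)
    also have "\<dots> = (\<Sum>j<?m. (-1) ^ j * Q2 x (ys ! j) * pf Q2 (del_nth j ys @ [0, 0]))"
      by simp
    also have "\<dots> = pf Q2 xs"
      using less.hyps by (simp add: Cons)
    finally show ?thesis .
  qed
qed

text \<open>The two last columns agree because \<open>Q2 x 0 = q x\<close>. This identifies the
  \<open>r = 0\<close> term of the recursion.\<close>

lemma pf_Q2_append_0:
  assumes "odd (length xs)"
  shows "pf Q2 (xs @ [0]) = pfaffian (M_skew_mat xs [0])"
  using assms by (simp add: pf_last_column pfaffian_M_skew_mat)

lemma Q_eq_pf_Q2:
  "Q lam = pf Q2 (if even (length lam) then lam else lam @ [0])"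
  by (simp add: Q_def pfaffian_M_mat)

section \<open>Contribution of the zero parts\<close>

lemma is_partition_eq:
  "is_partition xs \<Longrightarrow>
    xs = filter (\<lambda>p. p \<noteq> 0) xs @ replicate (length xs - num_parts xs) 0"
proof (induction xs)
  case (Cons x xs)
  have part: "is_partition xs"
    using Cons.prems by (simp add: is_partition_def)
  have le: "num_parts xs \<le> length xs"
    by (simp add: num_parts_def)
  show ?case
  proof (cases "x = 0")
    case True
    then have "\<forall>p\<in>set xs. p = 0"
      using Cons.prems by (fastforce simp: is_partition_def)
    then have "xs = replicate (length xs) 0" "filter (\<lambda>p. p \<noteq> 0) xs = []"
      by (simp_all add: replicate_length_same)
    then show ?thesis
      using True by (simp add: num_parts_def)
  next
    case False
    then show ?thesis
      using Cons.IH[OF part] le by (simp add: num_parts_def Suc_diff_le)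
  qed
qed (simp add: num_parts_def)

lemma sum_alternating: "(\<Sum>i<n. (-1) ^ i :: 'a :: ring_1) = (if even n then 0 else 1)"
  by (induction n) auto

lemma sum_lessThan_add:
  "(\<Sum>i<m + n. g i) = (\<Sum>i<m. g i) + (\<Sum>i<n :: nat. g (m + i))"
  for g :: "nat \<Rightarrow> 'a :: comm_monoid_add"
  by (induction n) (simp_all add: add.assoc)

text \<open>Deleting any of the zeros leaves the same list, so its Pfaffian factors out of an
  alternating sum of \<open>z\<close> signs. If \<open>z\<close> is odd, then
  \<open>length A\<close> is even and the overall sign is \<open>+1\<close>.\<close>

lemma sum_zero_parts:
  assumes xs: "xs = A @ replicate z 0" and A: "0 \<notin> set A" and odd: "odd (length xs)"
  shows "(\<Sum>i<length xs. (-1) ^ i * (if xs ! i = 0 then 1 else 0) * pf Q2 (del_nth i xs)) =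
    (if odd z then pf Q2 (A @ replicate (z - 1) 0) else 0)"
proof -
  let ?g = "\<lambda>i. (-1) ^ i * (if xs ! i = 0 then 1 else 0) * pf Q2 (del_nth i xs)"
  have "(\<Sum>i<length xs. ?g i) = (\<Sum>i<length A. ?g i) + (\<Sum>i<z. ?g (length A + i))"
    by (simp only: xs length_append length_replicate sum_lessThan_add)
  also have "(\<Sum>i<length A. ?g i) = 0"
    using A by (intro sum.neutral) (auto simp: xs nth_append in_set_conv_nth)
  also have "(\<Sum>i<z. ?g (length A + i)) =
      (\<Sum>i<z. (-1) ^ length A * pf Q2 (A @ replicate (z - 1) 0) * (-1) ^ i)"
    by (intro sum.cong) (auto simp: xs nth_append del_nth_append del_nth_replicate power_add)
  also have "\<dots> = (if odd z then pf Q2 (A @ replicate (z - 1) 0) else 0)"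
    using odd by (auto simp: xs sum_distrib_left[symmetric] sum_alternating)
  finally show ?thesis
    by simp
qed

theorem corollary5p1:
  fixes lam :: "int list"
  assumes "is_partition lam"
  shows "if odd (num_parts lam)
    then summable (\<lambda>k. (-1) ^ Suc k * q (int (Suc k)) * Q_skew lam [int (Suc k)]) \<and>
         Q lam = - suminf (\<lambda>k. (-1) ^ Suc k * q (int (Suc k)) * Q_skew lam [int (Suc k)])
    else summable (\<lambda>r. (-1) ^ r * q (int r) * Q_skew lam [int r]) \<and>
         Q lam = suminf (\<lambda>r. (-1) ^ r * q (int r) * Q_skew lam [int r])"
proof -
  \<comment> \<open>The odd-length list that \<open>Q_skew lam [r]\<close> uses for every
    \<open>r\<close>.\<close>
  define L where "L = (if odd (length lam) then lam else lam @ [0])"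
  define A where "A = filter (\<lambda>p. p \<noteq> 0) L"
  define z where "z = length L - num_parts L"
  define t where "t = (\<lambda>r. (-1) ^ r * q (int r) * Q_skew lam [int r])"
  have odd: "odd (length L)"
    by (simp add: L_def)
  have part: "is_partition L"
    using assms by (auto simp: L_def is_partition_def sorted_wrt_append)
  have L: "L = A @ replicate z 0"
    using is_partition_eq[OF part] by (simp add: A_def z_def)
  have A0: "0 \<notin> set A"
    by (simp add: A_def)
  have num: "num_parts lam = length A"
    by (simp add: A_def L_def num_parts_def)
  have parity: "odd z \<longleftrightarrow> even (num_parts lam)"
    using odd num by (simp add: L)
  have nonneg: "0 \<le> L ! i" if "i < length L" for i
    using part that by (simp add: is_partition_def)
  have t: "t r = (\<Sum>i<length L. (-1) ^ i * ((-1) ^ r * q (int r) * q (L ! i - int r)) *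
      pf Q2 (del_nth i L))" for r
    using pfaffian_M_skew_mat[OF odd, of "int r"]
    by (simp add: t_def Q_skew_def L_def sum_distrib_left mult_ac split: if_splits)
  \<comment> \<open>A cutoff above all parts makes the sum over \<open>r\<close> finite, so that it
    can be interchanged with the expansion.\<close>
  obtain R where R: "\<And>i. i < length L \<Longrightarrow> L ! i < int R"
  proof
    fix i assume "i < length L"
    then show "L ! i < int (Suc (nat (Max (set L))))"
      using Max_ge[of "set L" "L ! i"] by (simp del: Max_ge)
  qed
  have t0: "t r = 0" if "R \<le> r" for r
    unfolding t using that R by (intro sum.neutral) fastforce
  have "(\<Sum>r<R. t r) = (\<Sum>i<length L. \<Sum>r<R. (-1) ^ i * ((-1) ^ r * q (int r) *
      q (L ! i - int r)) * pf Q2 (del_nth i L))"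
    unfolding t by (rule sum.swap)
  also have "\<dots> = (\<Sum>i<length L. (-1) ^ i * (\<Sum>r<R. (-1) ^ r * q (int r) *
      q (L ! i - int r)) * pf Q2 (del_nth i L))"
    by (simp only: sum_distrib_left sum_distrib_right)
  also have "\<dots> = (\<Sum>i<length L. (-1) ^ i * (if L ! i = 0 then 1 else 0) * pf Q2 (del_nth i L))"
    using R nonneg by (intro sum.cong refl) (simp add: q_convolution_upto)
  also have "\<dots> = (if odd z then pf Q2 (A @ replicate (z - 1) 0) else 0)"
    by (rule sum_zero_parts[OF L A0 odd])
  finally have total: "(\<Sum>r<R. t r) = (if odd z then pf Q2 (A @ replicate (z - 1) 0) else 0)" .
  \<comment> \<open>For \<open>lam\<close> of even length, \<open>L @ [0]\<close> is
    \<open>lam\<close> with two zeros appended.\<close>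
  have Q_L: "Q lam = pf Q2 (L @ [0])"
    using pf_Q2_append_0_0[of lam] by (simp add: Q_eq_pf_Q2 L_def)
  show ?thesis
  proof (cases "odd (num_parts lam)")
    case True
    \<comment> \<open>\<open>L\<close> has odd length, hence an entry, and this nonnegative entry
      lies below \<open>R\<close>; so the term \<open>r = 0\<close> can be split off.\<close>
    have "R > 0"
      using odd_pos[OF odd] R[of 0] nonneg[of 0] by (cases R) auto
    then obtain R' where R': "R = Suc R'"
      using gr0_implies_Suc by blast
    \<comment> \<open>Here \<open>z\<close> is even, so the total vanishes.\<close>
    have "t 0 + (\<Sum>k<R'. t (Suc k)) = 0"
      using total True parity by (simp add: R' sum.lessThan_Suc_shift del: sum.lessThan_Suc)
    moreover have "t 0 = Q lam"
      using pf_Q2_append_0[OF odd] Q_L by (simp add: t_def Q_skew_def L_def split: if_splits)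
    ultimately have "Q lam = - (\<Sum>k<R'. t (Suc k))"
      by (simp add: eq_neg_iff_add_eq_0)
    moreover have "(\<lambda>k. t (Suc k)) sums (\<Sum>k<R'. t (Suc k))"
      using t0 by (intro sums_finite) (auto simp: R')
    ultimately have "summable (\<lambda>k. t (Suc k)) \<and> Q lam = - suminf (\<lambda>k. t (Suc k))"
      by (auto simp: sums_iff)
    then show ?thesis
      using True unfolding t_def by simp
  next
    case False
    then have "odd z"
      using parity by simp
    \<comment> \<open>As \<open>z\<close> is odd, \<open>L\<close> ends in a zero; together with the
      zero appended in \<open>Q_L\<close> it forms a removable pair.\<close>
    then have "L = (A @ replicate (z - 1) 0) @ [0]"
      unfolding L by (cases z) (simp_all add: replicate_append_same)
    then have "Q lam = pf Q2 (A @ replicate (z - 1) 0)"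
      using Q_L pf_Q2_append_0_0[of "A @ replicate (z - 1) 0"] by simp
    then have "Q lam = (\<Sum>r<R. t r)"
      using total \<open>odd z\<close> by simp
    moreover have "t sums (\<Sum>r<R. t r)"
      using t0 by (intro sums_finite) auto
    ultimately have "summable t \<and> Q lam = suminf t"
      by (auto simp: sums_iff)
    then show ?thesis
      using False unfolding t_def by simp
  qed
qed

end
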